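(* Let $A\in\mathbb{R}_+^{n\times n}$ and let $\mathbf{X}\subseteq\mathbb{R}_+^n$ be an interval. (1) If $A$ is weakly $(\mathbf{X},\lambda)$-robust, then $A$ has $\mathbf{X}$-simple image eigencone associated with $\lambda$. (2) If $A$ has $\mathbf{X}$-simple image eigencone associated with $\lambda$ and if $\mathbf{X}$ is invariant under $A$, then $A$ is weakly $(\mathbf{X},\lambda)$-robust.
   Context: Max algebra: $\mathbb{R}_+$ is the set of nonnegative reals with $a\otimes b=ab$, $a\oplus b=\max(a,b)$, extended to matrices and vectors in the usual way, so $(A\otimes x)_i=\max_j a_{ij}x_j$; $A^{\otimes t}$ is the $t$-th max-algebraic power. For $\lambda\ge 0$, $V(A,\lambda)=\{x\in\mathbb{R}_+^n:A\otimes x=\lambda x\}$ is the eigencone of $A$ associated with $\lambda$; its nonzero vectors are the eigenvectors of $A$ associated with $\lambda$, and $\lambda$ is an eigenvalue of $A$ if such eigenvectors exist. An interval of $\mathbb{R}_+^n$ is a set $\mathbf{X}=\mathbf{X}_1\times\dots\times\mathbf{X}_n$, where each $\mathbf{X}_i\subseteq\mathbb{R}_+$ is an arbitrary interval (each end may or may not belong to it; the upper end may be $+\infty$ and the lower end may be $0$). $\operatorname{attr}(A,\lambda)=\{x: A^{\otimes t}\otimes x\in V(A,\lambda)\text{ for some } t\}$. $A$ is called weakly $(\mathbf{X},\lambda)$-robust if $\operatorname{attr}(A,\lambda)\cap\mathbf{X}\subseteq V(A,\lambda)$. $A$ is said to have $\mathbf{X}$-simple image eigencone associated with a (fixed) eigenvalue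 $\lambda$ if any eigenvector $x$ associated with the eigenvalue $\lambda$ and belonging to $\mathbf{X}$ is the unique solution $y$ in $\mathbf{X}$ of the system $A\otimes y=\lambda x$. $\mathbf{X}$ is invariant under $A$ if $x\in\mathbf{X}$ implies $A\otimes x\in\mathbf{X}$.
   Formalization: Part (1) is stated for λ>0 only (it fails for λ=0, A=0, X=R_+^n); part (2) also assumes that if X∩V(A,λ)={0} then y=0 is the only y in X with A⊗y=0 (without this it fails for A=[[0,1],[0,1]], λ=1, X=[0,1]×{0}). *)

theory Defs
  imports "HOL-Analysis.Analysis"
begin

text \<open>
  Vectors over \<open>\<real>\<^sub>+\<close> are elements of \<open>real ^ 'n\<close>, and matrices elements of
  \<open>real ^ 'n ^ 'n\<close>, with nonnegative entries; nonnegativity is stated explicitly where needed.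
\<close>

definition nonneg_vec :: "real ^ 'n \<Rightarrow> bool" where
  "nonneg_vec x \<longleftrightarrow> (\<forall>i. 0 \<le> x $ i)"

definition nonneg_mat :: "real ^ 'n ^ 'm \<Rightarrow> bool" where
  "nonneg_mat A \<longleftrightarrow> (\<forall>i j. 0 \<le> A $ i $ j)"

definition max_mat_vec :: "real ^ 'n ^ 'm \<Rightarrow> real ^ 'n \<Rightarrow> real ^ 'm"  (infixr "\<otimes>\<^sub>v" 70) where
  "A \<otimes>\<^sub>v x = (\<chi> i. MAX j. A $ i $ j * x $ j)"

definition max_mat_mat :: "real ^ 'n ^ 'm \<Rightarrow> real ^ 'p ^ 'n \<Rightarrow> real ^ 'p ^ 'm"  (infixr "\<otimes>\<^sub>m" 70) where
  "A \<otimes>\<^sub>m B = (\<chi> i k. MAX j. A $ i $ j * B $ j $ k)"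

text \<open>The ordinary identity matrix is also the max-algebraic one.\<close>

primrec max_mat_power :: "real ^ 'n ^ 'n \<Rightarrow> nat \<Rightarrow> real ^ 'n ^ 'n" where
  "max_mat_power A 0 = mat 1"
| "max_mat_power A (Suc t) = A \<otimes>\<^sub>m max_mat_power A t"

definition eigencone :: "real ^ 'n ^ 'n \<Rightarrow> real \<Rightarrow> (real ^ 'n) set" where
  "eigencone A l = {x. nonneg_vec x \<and> A \<otimes>\<^sub>v x = l *\<^sub>R x}"

definition max_eigenvector :: "real ^ 'n ^ 'n \<Rightarrow> real \<Rightarrow> real ^ 'n \<Rightarrow> bool" where
  "max_eigenvector A l x \<longleftrightarrow> x \<in> eigencone A l \<and> x \<noteq> 0"

definition max_eigenvalue :: "real ^ 'n ^ 'n \<Rightarrow> real \<Rightarrow> bool" where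
  "max_eigenvalue A l \<longleftrightarrow> 0 \<le> l \<and> (\<exists>x. max_eigenvector A l x)"

text \<open>
  The factors are arbitrary (order-convex) subsets of \<open>\<real>\<^sub>+\<close>: each end may or may not
  belong to the factor, and the upper end may be infinite.
\<close>

definition nonneg_interval :: "(real ^ 'n) set \<Rightarrow> bool" where
  "nonneg_interval X \<longleftrightarrow>
     (\<exists>I :: 'n \<Rightarrow> real set. (\<forall>i. is_interval (I i) \<and> I i \<subseteq> {0..}) \<and> X = {x. \<forall>i. x $ i \<in> I i})"

definition attraction_set :: "real ^ 'n ^ 'n \<Rightarrow> real \<Rightarrow> (real ^ 'n) set" where
  "attraction_set A l = {x. nonneg_vec x \<and> (\<exists>t. max_mat_power A t \<otimes>\<^sub>v x \<in> eigencone A l)}"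

definition weakly_robust :: "real ^ 'n ^ 'n \<Rightarrow> (real ^ 'n) set \<Rightarrow> real \<Rightarrow> bool" where
  "weakly_robust A X l \<longleftrightarrow> attraction_set A l \<inter> X \<subseteq> eigencone A l"

text \<open>
  For an eigenvector \<open>x \<in> X\<close>, \<open>y = x\<close> is always a solution, so the equivalence below says
  that it is the only one in \<open>X\<close>. The zero vector is not an eigenvector, so nothing is required
  of \<open>x = 0\<close>.
\<close>

definition simple_image_eigencone :: "real ^ 'n ^ 'n \<Rightarrow> (real ^ 'n) set \<Rightarrow> real \<Rightarrow> bool" where
  "simple_image_eigencone A X l \<longleftrightarrow>
     (\<forall>x. max_eigenvector A l x \<and> x \<in> X \<longrightarrow> (\<forall>y\<in>X. A \<otimes>\<^sub>v y = l *\<^sub>R x \<longleftrightarrow> y = x))"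

definition invariant_under :: "real ^ 'n ^ 'n \<Rightarrow> (real ^ 'n) set \<Rightarrow> bool" where
  "invariant_under A X \<longleftrightarrow> (\<forall>x\<in>X. A \<otimes>\<^sub>v x \<in> X)"

end

theory Submission
  imports Defs
begin

text \<open>
  For (1), \<open>A \<otimes> y = \<lambda>x\<close> with \<open>x\<close> an eigenvector puts \<open>y\<close> into the attraction set after one step,
  so \<open>y\<close> is itself in the eigencone and \<open>\<lambda>y = \<lambda>x\<close>.

  For (2), it suffices to descend one step along the orbit: if \<open>z \<in> X\<close> and \<open>w = A \<otimes> z\<close> is in the
  eigencone, then so is \<open>z\<close>. The difficulty is that \<open>w / \<lambda>\<close> need not lie in \<open>X\<close>, so that
  simplicity cannot be applied to \<open>A \<otimes> z = \<lambda>(w / \<lambda>)\<close>. Instead one shows \<open>\<lambda>z \<in> X\<close> and applies it to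
  \<open>A \<otimes> (\<lambda>z) = \<lambda>w\<close>. By invariance all \<open>\<lambda>\<^sup>k w\<close> lie in \<open>X\<close>, so on the support of \<open>w\<close> the factors of
  \<open>X\<close> reach down to 0 (if \<open>\<lambda> < 1\<close>) or up to infinity (if \<open>\<lambda> > 1\<close>); in the latter case one
  first sees that \<open>z\<close> vanishes off the support of \<open>w\<close>, by comparing \<open>w\<close> with the vector
  obtained from \<open>w\<close> by inserting the entries of \<open>z\<close> off its support.
\<close>

section \<open>Max-algebraic matrix-vector products\<close>

lemma max_mat_vec_ge: "A $ i $ j * x $ j \<le> (A \<otimes>\<^sub>v x) $ i"
  by (auto simp: max_mat_vec_def intro: Max_ge)

lemma max_mat_vec_attained: "\<exists>j. (A \<otimes>\<^sub>v x) $ i = A $ i $ j * x $ j"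
proof -
  have "(MAX j. A $ i $ j * x $ j) \<in> range (\<lambda>j. A $ i $ j * x $ j)"
    by (rule Max_in) auto
  then show ?thesis unfolding max_mat_vec_def vec_lambda_beta by blast
qed

lemma max_mat_vec_le_iff: "(A \<otimes>\<^sub>v x) $ i \<le> c \<longleftrightarrow> (\<forall>j. A $ i $ j * x $ j \<le> c)"
  by (auto simp: max_mat_vec_def)

lemma max_mat_mat_le_iff: "(A \<otimes>\<^sub>m B) $ i $ k \<le> c \<longleftrightarrow> (\<forall>j. A $ i $ j * B $ j $ k \<le> c)"
  by (auto simp: max_mat_mat_def)

lemma max_mat_mat_attained: "\<exists>j. (A \<otimes>\<^sub>m B) $ i $ k = A $ i $ j * B $ j $ k"
proof -
  have "(MAX j. A $ i $ j * B $ j $ k) \<in> range (\<lambda>j. A $ i $ j * B $ j $ k)"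
    by (rule Max_in) auto
  then show ?thesis unfolding max_mat_mat_def vec_lambda_beta by blast
qed

lemma max_mat_vec_zero [simp]: "A \<otimes>\<^sub>v 0 = 0"
  by (simp add: max_mat_vec_def vec_eq_iff)

lemma max_mat_vec_scaleR:
  assumes "0 \<le> c"
  shows "A \<otimes>\<^sub>v (c *\<^sub>R x) = c *\<^sub>R (A \<otimes>\<^sub>v x)"
proof (unfold vec_eq_iff, intro allI antisym)
  fix i
  show "(A \<otimes>\<^sub>v (c *\<^sub>R x)) $ i \<le> (c *\<^sub>R (A \<otimes>\<^sub>v x)) $ i"
    by (simp add: max_mat_vec_le_iff[of A "c *\<^sub>R x"] mult.left_commute
        mult_left_mono max_mat_vec_ge assms)
  obtain j where "(A \<otimes>\<^sub>v x) $ i = A $ i $ j * x $ j" using max_mat_vec_attained by blast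
  then show "(c *\<^sub>R (A \<otimes>\<^sub>v x)) $ i \<le> (A \<otimes>\<^sub>v (c *\<^sub>R x)) $ i"
    using max_mat_vec_ge[of A i j "c *\<^sub>R x"] by (simp add: mult.left_commute)
qed

text \<open>Only nonnegative factors can be moved through \<open>MAX\<close>: the entries of
  \<open>A\<close> pass through the inner maximum over \<open>k\<close>, those of \<open>x\<close>
  through the one over \<open>j\<close>.\<close>

lemma max_mat_vec_assoc:
  assumes A: "nonneg_mat A" and x: "nonneg_vec x"
  shows "(A \<otimes>\<^sub>m B) \<otimes>\<^sub>v x = A \<otimes>\<^sub>v B \<otimes>\<^sub>v x"
proof (unfold vec_eq_iff, intro allI antisym)
  fix i
  show "((A \<otimes>\<^sub>m B) \<otimes>\<^sub>v x) $ i \<le> (A \<otimes>\<^sub>v B \<otimes>\<^sub>v x) $ i"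
    unfolding max_mat_vec_le_iff[of "A \<otimes>\<^sub>m B"]
  proof
    fix k
    obtain j where "(A \<otimes>\<^sub>m B) $ i $ k = A $ i $ j * B $ j $ k"
      using max_mat_mat_attained by blast
    then have "(A \<otimes>\<^sub>m B) $ i $ k * x $ k = A $ i $ j * (B $ j $ k * x $ k)" by simp
    also have "\<dots> \<le> A $ i $ j * (B \<otimes>\<^sub>v x) $ j"
      using A by (intro mult_left_mono max_mat_vec_ge) (simp add: nonneg_mat_def)
    also have "\<dots> \<le> (A \<otimes>\<^sub>v B \<otimes>\<^sub>v x) $ i" by (rule max_mat_vec_ge)
    finally show "(A \<otimes>\<^sub>m B) $ i $ k * x $ k \<le> (A \<otimes>\<^sub>v B \<otimes>\<^sub>v x) $ i" .
  qed
  show "(A \<otimes>\<^sub>v B \<otimes>\<^sub>v x) $ i \<le> ((A \<otimes>\<^sub>m B) \<otimes>\<^sub>v x) $ i"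
    unfolding max_mat_vec_le_iff[of A]
  proof
    fix j
    obtain k where "(B \<otimes>\<^sub>v x) $ j = B $ j $ k * x $ k" using max_mat_vec_attained by blast
    then have "A $ i $ j * (B \<otimes>\<^sub>v x) $ j = (A $ i $ j * B $ j $ k) * x $ k" by simp
    also have "\<dots> \<le> (A \<otimes>\<^sub>m B) $ i $ k * x $ k"
      using x max_mat_mat_le_iff[of A B i k "(A \<otimes>\<^sub>m B) $ i $ k"]
      by (intro mult_right_mono) (auto simp: nonneg_vec_def)
    also have "\<dots> \<le> ((A \<otimes>\<^sub>m B) \<otimes>\<^sub>v x) $ i" by (rule max_mat_vec_ge)
    finally show "A $ i $ j * (B \<otimes>\<^sub>v x) $ j \<le> ((A \<otimes>\<^sub>m B) \<otimes>\<^sub>v x) $ i" .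
  qed
qed

lemma max_mat_vec_mat_1:
  fixes x :: "real ^ 'n"
  assumes "nonneg_vec x"
  shows "mat 1 \<otimes>\<^sub>v x = x"
proof (unfold vec_eq_iff, intro allI antisym)
  fix i
  show "(mat 1 \<otimes>\<^sub>v x) $ i \<le> x $ i"
    using assms by (auto simp: max_mat_vec_le_iff mat_def nonneg_vec_def)
  show "x $ i \<le> (mat 1 \<otimes>\<^sub>v x) $ i"
    using max_mat_vec_ge[of "mat 1" i i x] by (simp add: mat_def)
qed

lemma max_mat_vec_eqI:
  assumes "\<And>i j. A $ i $ j * x $ j \<le> b $ i" "\<And>i. b $ i \<le> (A \<otimes>\<^sub>v x) $ i"
  shows "A \<otimes>\<^sub>v x = b"
  using assms by (auto simp: vec_eq_iff max_mat_vec_le_iff intro!: antisym)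

lemma max_mat_vec_mono:
  assumes "nonneg_mat A" "\<And>j. x $ j \<le> y $ j"
  shows "(A \<otimes>\<^sub>v x) $ i \<le> (A \<otimes>\<^sub>v y) $ i"
  unfolding max_mat_vec_le_iff[of A x]
proof
  fix j
  have "A $ i $ j * x $ j \<le> A $ i $ j * y $ j"
    using assms by (intro mult_left_mono) (auto simp: nonneg_mat_def)
  then show "A $ i $ j * x $ j \<le> (A \<otimes>\<^sub>v y) $ i" using max_mat_vec_ge order_trans by blast
qed

section \<open>Intervals and eigencones\<close>

lemma nonneg_interval_nonneg: "nonneg_interval X \<Longrightarrow> x \<in> X \<Longrightarrow> nonneg_vec x"
  by (auto simp: nonneg_interval_def nonneg_vec_def)

text \<open>The bounds \<open>a\<close> and \<open>b\<close> may change with the coordinate, because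
  \<open>X\<close> is a product of order-convex factors. Vectors patched together from several
  members of \<open>X\<close> are thus again in \<open>X\<close>.\<close>

lemma nonneg_interval_memI:
  assumes X: "nonneg_interval X"
    and between: "\<And>i. \<exists>a\<in>X. \<exists>b\<in>X. a $ i \<le> y $ i \<and> y $ i \<le> b $ i"
  shows "y \<in> X"
proof -
  obtain I where I: "\<forall>i. is_interval (I i) \<and> I i \<subseteq> {0..}" "X = {x. \<forall>i. x $ i \<in> I i}"
    using X unfolding nonneg_interval_def by (elim exE conjE)
  have "y $ i \<in> I i" for i
  proof -
    obtain a b where ab: "a \<in> X" "b \<in> X" "a $ i \<le> y $ i" "y $ i \<le> b $ i"
      using between[of i] by (elim bexE conjE)
    have "a $ i \<in> I i" "b $ i \<in> I i" using ab(1,2) I(2) by simp_all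
    then show ?thesis using ab(3,4) I(1) mem_is_interval_1_I by blast
  qed
  then show ?thesis by (simp add: I(2))
qed

text \<open>\<open>A\<close> acts on the ray through \<open>w\<close> as multiplication by
  \<open>l\<close>, so invariance leads from one power to the next.\<close>

lemma eigencone_power_mem:
  assumes "invariant_under A X" "0 \<le> l" "w \<in> X" "A \<otimes>\<^sub>v w = l *\<^sub>R w"
  shows "l ^ k *\<^sub>R w \<in> X"
proof (induction k)
  case (Suc k)
  have "A \<otimes>\<^sub>v (l ^ k *\<^sub>R w) = l ^ Suc k *\<^sub>R w"
    using assms(2,4) by (simp add: max_mat_vec_scaleR mult.commute)
  then show ?case using Suc assms(1) by (metis invariant_under_def)
qed (use assms in simp)

lemma simple_imageD:
  assumes "simple_image_eigencone A X l" "w \<in> eigencone A l" "w \<noteq> 0" "w \<in> X"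
    "y \<in> X" "A \<otimes>\<^sub>v y = l *\<^sub>R w"
  shows "y = w"
  using assms unfolding simple_image_eigencone_def max_eigenvector_def by blast

text \<open>
  The componentwise maximum of \<open>z\<close> and \<open>\<epsilon>v\<close> has the same image as the eigenvector \<open>\<epsilon>v\<close>, so
  simplicity gives \<open>z \<le> \<epsilon>v\<close> for all \<open>0 < \<epsilon> \<le> 1\<close>.
\<close>

lemma kernel_trivial:
  assumes A: "nonneg_mat A" and X: "nonneg_interval X"
    and simple: "simple_image_eigencone A X l" and l: "0 \<le> l"
    and v: "v \<in> eigencone A l" "v \<noteq> 0" "v \<in> X" and "0 \<in> X"
    and z: "z \<in> X" "A \<otimes>\<^sub>v z = 0"
  shows "z = 0"
proof -
  have v0: "0 \<le> v $ i" and z0: "0 \<le> z $ i" for i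
    using nonneg_interval_nonneg[OF X] v(3) z(1) by (auto simp: nonneg_vec_def)
  have bound: "z $ i \<le> e * v $ i" if e: "0 < e" "e \<le> 1" for e i
  proof -
    define u where "u = e *\<^sub>R v"
    have "0 $ i \<le> u $ i \<and> u $ i \<le> v $ i" for i
      using e v0[of i] by (simp add: u_def mult_left_le_one_le)
    then have "u \<in> X"
      by (intro nonneg_interval_memI[OF X] bexI[OF _ \<open>0 \<in> X\<close>] bexI[OF _ v(3)])
    moreover have "u \<noteq> 0" using e v by (simp add: u_def)
    ultimately have u: "u \<in> X" "u \<noteq> 0" by auto
    have Au: "A \<otimes>\<^sub>v u = l *\<^sub>R u"
      using v(1) e by (simp add: u_def max_mat_vec_scaleR eigencone_def)
    have ucone: "u \<in> eigencone A l"
      using Au nonneg_interval_nonneg[OF X u(1)] by (simp add: eigencone_def)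
    define y :: "real ^ 'a" where "y = (\<chi> j. max (z $ j) (u $ j))"
    have "y \<in> X"
    proof (rule nonneg_interval_memI[OF X])
      fix i show "\<exists>a\<in>X. \<exists>b\<in>X. a $ i \<le> y $ i \<and> y $ i \<le> b $ i"
        using z(1) u(1) by (cases "z $ i \<le> u $ i") (auto simp: y_def max_def)
    qed
    moreover have "A \<otimes>\<^sub>v y = l *\<^sub>R u"
    proof (rule max_mat_vec_eqI)
      fix i j
      have "A $ i $ j * z $ j \<le> (l *\<^sub>R u) $ i"
        using max_mat_vec_ge[of A i j z] z(2) l nonneg_interval_nonneg[OF X u(1)]
        by (auto simp: nonneg_vec_def intro: order_trans[of _ 0])
      moreover have "A $ i $ j * u $ j \<le> (l *\<^sub>R u) $ i"
        using max_mat_vec_ge[of A i j u] Au by simp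
      ultimately show "A $ i $ j * y $ j \<le> (l *\<^sub>R u) $ i"
        by (auto simp: y_def max_def)
    next
      fix i show "(l *\<^sub>R u) $ i \<le> (A \<otimes>\<^sub>v y) $ i"
        unfolding Au[symmetric] by (rule max_mat_vec_mono[OF A]) (simp add: y_def)
    qed
    ultimately have "y = u" using simple_imageD[OF simple ucone u(2,1)] by blast
    then have "z $ i \<le> u $ i" by (metis max.cobounded1 vec_lambda_beta y_def)
    then show ?thesis by (simp add: u_def)
  qed
  have "z $ i = 0" for i
  proof (rule ccontr)
    assume "z $ i \<noteq> 0"
    then have zi: "0 < z $ i" using z0[of i] by simp
    moreover from zi have vi: "z $ i \<le> v $ i" using bound[of 1 i] by simp
    \<comment> \<open>The choice \<open>e = z $ i / (2 * v $ i)\<close> is at most 1/2 by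
      \<open>vi\<close>, and the bound becomes \<open>z $ i \<le> z $ i / 2\<close>.\<close>
    ultimately have "z $ i \<le> z $ i / (2 * v $ i) * v $ i"
      by (intro bound) (auto simp: divide_simps)
    then show False using zi vi by simp
  qed
  then show ?thesis by (simp add: vec_eq_iff)
qed

section \<open>One step of descent along an orbit\<close>

lemma scaled_preimage_mem:
  assumes A: "nonneg_mat A" and X: "nonneg_interval X"
    and simple: "simple_image_eigencone A X l" and inv: "invariant_under A X" and l: "0 < l"
    and z: "z \<in> X" and w: "A \<otimes>\<^sub>v z = w" "w \<in> eigencone A l" "w \<noteq> 0"
  shows "l *\<^sub>R z \<in> X"
proof -
  have wX: "w \<in> X" using z inv w(1) by (auto simp: invariant_under_def)
  have Aw: "A \<otimes>\<^sub>v w = l *\<^sub>R w" using w(2) by (simp add: eigencone_def)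
  have pow: "l ^ k *\<^sub>R w \<in> X" for k
    using eigencone_power_mem[OF inv _ wX Aw] l by simp
  have w0: "0 \<le> w $ i" and z0: "0 \<le> z $ i" for i
    using nonneg_interval_nonneg[OF X] wX z by (auto simp: nonneg_vec_def)
  consider "l < 1" | "l = 1" | "l > 1" by linarith
  then show ?thesis
  proof cases
    case 1
    show ?thesis
    proof (rule nonneg_interval_memI[OF X])
      fix i
      have up: "l * z $ i \<le> z $ i" using 1 l z0[of i] by (simp add: mult_left_le_one_le)
      \<comment> \<open>On the support of \<open>w\<close> the members
        \<open>l ^ k *\<^sub>R w\<close> of \<open>X\<close> tend to 0 and eventually serve as lower
        bounds; off it they already vanish. If \<open>z $ i = 0\<close>, then \<open>z\<close>
        itself is the lower bound.\<close>
      have ex: "\<exists>k. l ^ k * w $ i \<le> l * z $ i" if "z $ i > 0"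
      proof (cases "w $ i = 0")
        case False
        then have wi: "w $ i > 0" using w0[of i] by simp
        have "0 < l * z $ i / w $ i" using l that wi by simp
        then obtain k where "l ^ k < l * z $ i / w $ i"
          using real_arch_pow_inv 1 by blast
        then show ?thesis using wi by (auto simp: field_simps intro!: exI[of _ k])
      qed (use l that in simp)
      then obtain a where "a \<in> X" "a $ i \<le> l * z $ i"
      proof (cases "z $ i = 0")
        case False
        then obtain k where "l ^ k * w $ i \<le> l * z $ i" using ex z0[of i] by auto
        then show ?thesis using that[OF pow[of k]] by simp
      qed (use that[OF z] in simp)
      then show "\<exists>a\<in>X. \<exists>b\<in>X. a $ i \<le> (l *\<^sub>R z) $ i \<and> (l *\<^sub>R z) $ i \<le> b $ i"
        using z up by auto
    qed
  next
    case 2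
    then show ?thesis using z by simp
  next
    case 3
    define y :: "real ^ 'a" where "y = (\<chi> j. if w $ j = 0 then z $ j else w $ j)"
    have "y \<in> X"
    proof (rule nonneg_interval_memI[OF X])
      fix i show "\<exists>a\<in>X. \<exists>b\<in>X. a $ i \<le> y $ i \<and> y $ i \<le> b $ i"
        using z wX by (auto simp: y_def)
    qed
    \<comment> \<open>The inserted entries of \<open>z\<close> contribute at most
      \<open>w $ i\<close> to row \<open>i\<close>, and \<open>w \<le> l w\<close> since
      \<open>l > 1\<close>. The reverse inequality follows from \<open>w \<le> y\<close>.\<close>
    moreover have "A \<otimes>\<^sub>v y = l *\<^sub>R w"
    proof (rule max_mat_vec_eqI)
      fix i j
      have "A $ i $ j * z $ j \<le> w $ i" using max_mat_vec_ge[of A i j z] w(1) by simp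
      also have "\<dots> \<le> (l *\<^sub>R w) $ i" using 3 w0[of i] by (simp add: mult_le_cancel_right1)
      finally show "A $ i $ j * y $ j \<le> (l *\<^sub>R w) $ i"
        using max_mat_vec_ge[of A i j w] Aw by (simp add: y_def)
    next
      fix i show "(l *\<^sub>R w) $ i \<le> (A \<otimes>\<^sub>v y) $ i"
        unfolding Aw[symmetric] by (rule max_mat_vec_mono[OF A]) (simp add: y_def z0)
    qed
    ultimately have "y = w" using simple_imageD[OF simple w(2,3) wX] by blast
    then have supp: "z $ i = 0" if "w $ i = 0" for i
      using that by (auto simp: y_def vec_eq_iff split: if_splits)
    show ?thesis
    proof (rule nonneg_interval_memI[OF X])
      fix i
      have low: "z $ i \<le> l * z $ i" using 3 z0[of i] by (simp add: mult_le_cancel_right1)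
      \<comment> \<open>The powers of \<open>l\<close> are now unbounded, but
        \<open>l ^ k *\<^sub>R w\<close> grows only on the support of \<open>w\<close>; elsewhere
        \<open>supp\<close> makes both sides 0.\<close>
      have "\<exists>k. l * z $ i \<le> l ^ k * w $ i"
      proof (cases "w $ i = 0")
        case False
        then have wi: "w $ i > 0" using w0[of i] by simp
        obtain k where "l * z $ i / w $ i < l ^ k" using real_arch_pow[OF 3] by blast
        then show ?thesis using wi by (auto simp: field_simps intro!: exI[of _ k])
      qed (simp add: supp)
      then obtain k where "l * z $ i \<le> (l ^ k *\<^sub>R w) $ i" by auto
      then show "\<exists>a\<in>X. \<exists>b\<in>X. a $ i \<le> (l *\<^sub>R z) $ i \<and> (l *\<^sub>R z) $ i \<le> b $ i"
        using low by (intro bexI[OF _ z] bexI[OF _ pow[of k]]) simp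
    qed
  qed
qed

text \<open>A nonzero image is handled by rescaling \<open>z\<close>. A zero image forces
  \<open>z = 0\<close> by \<open>kernel_trivial\<close> when \<open>X\<close> contains an
  eigenvector; otherwise simplicity is vacuous, and \<open>triv\<close> supplies the
  conclusion.\<close>

lemma eigencone_preimage:
  assumes A: "nonneg_mat A" and X: "nonneg_interval X" and l: "0 \<le> l"
    and triv: "X \<inter> eigencone A l = {0} \<longrightarrow> (\<forall>y\<in>X. A \<otimes>\<^sub>v y = 0 \<longrightarrow> y = 0)"
    and simple: "simple_image_eigencone A X l" and inv: "invariant_under A X"
    and z: "z \<in> X" and Az: "A \<otimes>\<^sub>v z \<in> eigencone A l"
  shows "z \<in> eigencone A l"
proof -
  define w where "w = A \<otimes>\<^sub>v z"
  have w: "A \<otimes>\<^sub>v z = w" "w \<in> eigencone A l" "A \<otimes>\<^sub>v w = l *\<^sub>R w"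
    using Az by (auto simp: w_def eigencone_def)
  have wX: "w \<in> X" using z inv w(1) by (auto simp: invariant_under_def)
  have znn: "nonneg_vec z" using nonneg_interval_nonneg[OF X z] .
  show ?thesis
  proof (cases "w = 0")
    case True
    have "z = 0"
    proof (cases "X \<inter> eigencone A l = {0}")
      case True
      then show ?thesis using triv z w(1) \<open>w = 0\<close> by auto
    next
      case False
      then obtain v where "v \<in> eigencone A l" "v \<noteq> 0" "v \<in> X"
        using wX w(2) \<open>w = 0\<close> by blast
      then show ?thesis
        using kernel_trivial[OF A X simple l _ _ _ _ z] wX w(1) \<open>w = 0\<close> by simp
    qed
    then show ?thesis using w(2) True by simp
  next
    case False
    \<comment> \<open>For \<open>l = 0\<close>, invariance puts
      \<open>A \<otimes>\<^sub>v w = 0\<close> into \<open>X\<close>, where 0 would be a second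
      solution of \<open>A \<otimes>\<^sub>v y = l *\<^sub>R w\<close>.\<close>
    have "l \<noteq> 0"
    proof
      assume "l = 0"
      then have "0 \<in> X" using wX w(3) inv by (force simp: invariant_under_def)
      then show False using simple_imageD[OF simple w(2) False wX, of 0] False \<open>l = 0\<close> by simp
    qed
    then have l0: "0 < l" using l by simp
    have "l *\<^sub>R z \<in> X"
      by (rule scaled_preimage_mem[OF A X simple inv l0 z w(1,2) False])
    then have "l *\<^sub>R z = w"
      using simple_imageD[OF simple w(2) False wX] w(1) l by (simp add: max_mat_vec_scaleR)
    then show ?thesis using znn w(1) by (simp add: eigencone_def)
  qed
qed

section \<open>The two implications between robustness and simplicity\<close>

text \<open>Positivity of \<open>l\<close> allows cancelling in
  \<open>l *\<^sub>R y = l *\<^sub>R x\<close>. For \<open>l = 0\<close> every member of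
  \<open>X\<close> with zero image would solve the system.\<close>

lemma weakly_robust_imp_simple_image:
  assumes A: "nonneg_mat A" and X: "nonneg_interval X" and l: "0 < l"
    and robust: "weakly_robust A X l"
  shows "simple_image_eigencone A X l"
proof -
  have "y = x" if x: "x \<in> eigencone A l" "x \<in> X" and y: "y \<in> X" "A \<otimes>\<^sub>v y = l *\<^sub>R x" for x y
  proof -
    have ynn: "nonneg_vec y" using nonneg_interval_nonneg[OF X y(1)] .
    have "A \<otimes>\<^sub>v y \<in> eigencone A l"
      using x(1) y(2) l by (auto simp: eigencone_def max_mat_vec_scaleR nonneg_vec_def)
    then have "max_mat_power A (Suc 0) \<otimes>\<^sub>v y \<in> eigencone A l"
      by (simp add: max_mat_vec_assoc[OF A ynn] max_mat_vec_mat_1[OF ynn])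
    then have "y \<in> eigencone A l"
      using robust y(1) ynn unfolding weakly_robust_def attraction_set_def by blast
    then show ?thesis using y(2) l by (simp add: eigencone_def)
  qed
  then show ?thesis
    by (auto simp: simple_image_eigencone_def max_eigenvector_def eigencone_def)
qed

lemma simple_image_imp_weakly_robust:
  assumes A: "nonneg_mat A" and X: "nonneg_interval X" and l: "0 \<le> l"
    and triv: "X \<inter> eigencone A l = {0} \<longrightarrow> (\<forall>y\<in>X. A \<otimes>\<^sub>v y = 0 \<longrightarrow> y = 0)"
    and simple: "simple_image_eigencone A X l" and inv: "invariant_under A X"
  shows "weakly_robust A X l"
proof -
  have "x \<in> eigencone A l"
    if x: "x \<in> X" and "max_mat_power A t \<otimes>\<^sub>v x \<in> eigencone A l" for x t
  proof -
    have xnn: "nonneg_vec x" using nonneg_interval_nonneg[OF X x] .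
    have one: "max_mat_power A 0 \<otimes>\<^sub>v x = x"
      by (simp add: max_mat_vec_mat_1[OF xnn])
    have Suc_power: "max_mat_power A (Suc s) \<otimes>\<^sub>v x = A \<otimes>\<^sub>v max_mat_power A s \<otimes>\<^sub>v x" for s
      by (simp add: max_mat_vec_assoc[OF A xnn])
    have orbit: "max_mat_power A s \<otimes>\<^sub>v x \<in> X" for s
    proof (induction s)
      case 0
      then show ?case using one x by metis
    next
      case (Suc s)
      then show ?case using Suc_power inv unfolding invariant_under_def by metis
    qed
    show ?thesis
      \<comment> \<open>Induction on \<open>t\<close> peels off the outermost factor
        \<open>A\<close>: the orbit stays in \<open>X\<close>, so \<open>eigencone_preimage\<close>
        applies at each of its points.\<close>
      using that(2)
    proof (induction t)
      case 0
      then show ?case using one by metis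
    next
      case (Suc t)
      then show ?case
        using eigencone_preimage[OF A X l triv simple inv orbit[of t]] Suc_power by metis
    qed
  qed
  then show ?thesis by (auto simp: weakly_robust_def attraction_set_def)
qed

theorem theorem4p4:
  fixes A :: "real ^ 'n ^ 'n" and X :: "(real ^ 'n) set" and l :: real
  assumes "nonneg_mat A" and "nonneg_interval X" and "max_eigenvalue A l"
  shows "(0 < l \<longrightarrow> weakly_robust A X l \<longrightarrow> simple_image_eigencone A X l) \<and>
         ((X \<inter> eigencone A l = {0} \<longrightarrow> (\<forall>y\<in>X. A \<otimes>\<^sub>v y = 0 \<longrightarrow> y = 0)) \<longrightarrow>
            simple_image_eigencone A X l \<longrightarrow> invariant_under A X \<longrightarrow> weakly_robust A X l)"
proof -
  have "0 \<le> l" using assms(3) by (simp add: max_eigenvalue_def)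
  then show ?thesis
    using weakly_robust_imp_simple_image[OF assms(1,2)]
      simple_image_imp_weakly_robust[OF assms(1,2)] by blast
qed

end
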